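(* Let $R$ be a commutative artinian ring and let $\mathcal{S}$ be a Serre subcategory of $R$-Mod. Then $\mathcal{S}$ satisfies the $C_{\mathfrak{a}}$ condition for each ideal $\mathfrak{a}$ of $R$.
   Context: $R$-Mod is the category of $R$-modules; all subcategories are full (identified with their classes of objects). A subcategory is Serre if it is closed under taking submodules, quotients and extensions. For an ideal $\mathfrak{a}$ and an $R$-module $M$, $\Gamma_{\mathfrak{a}}(M)=\{m\in M : \mathfrak{a}^k m=0 \text{ for some } k\ge 1\}$ and $(0:_M\mathfrak{a})=\{m\in M:\mathfrak{a}m=0\}$. A class $\mathcal{S}$ of $R$-modules satisfies the $C_{\mathfrak{a}}$ condition if for every $R$-module $M$: $\Gamma_{\mathfrak{a}}(M)=M$ and $(0:_M\mathfrak{a})\in\mathcal{S}$ imply $M\in\mathcal{S}$. *)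

theory Defs
  imports "HOL-Algebra.Algebra"
begin

text \<open>
  A class of \<open>R\<close>-modules is a set of \<open>R\<close>-modules whose carriers lie in one type \<open>'m\<close>. The type
  \<open>'m\<close> is arbitrary and plays the role of the universe in which \<open>R\<close>-Mod is formed.
\<close>

(* Two-sided ideals are used, hence the restriction to commutative rings. *)
locale artinian_cring = cring +
  assumes descending_chain:
    "\<lbrakk>\<And>n::nat. ideal (I n) R; \<And>n. I (Suc n) \<subseteq> I n\<rbrakk> \<Longrightarrow> \<exists>n. \<forall>m\<ge>n. I m = I n"

definition module_hom ::
    "('a, 'r) ring_scheme \<Rightarrow> ('a, 'm, 'c) module_scheme \<Rightarrow> ('a, 'n, 'd) module_scheme \<Rightarrow> ('m \<Rightarrow> 'n) set"
  where "module_hom R M N =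
    {h \<in> hom (add_monoid M) (add_monoid N).
      \<forall>r\<in>carrier R. \<forall>x\<in>carrier M. h (r \<odot>\<^bsub>M\<^esub> x) = r \<odot>\<^bsub>N\<^esub> h x}"

(* Exactness of 0 --> A --f--> B --g--> C --> 0. *)
definition short_exact ::
    "('a, 'r) ring_scheme \<Rightarrow> ('a, 'l, 'c) module_scheme \<Rightarrow> ('l \<Rightarrow> 'm) \<Rightarrow>
      ('a, 'm, 'd) module_scheme \<Rightarrow> ('m \<Rightarrow> 'n) \<Rightarrow> ('a, 'n, 'e) module_scheme \<Rightarrow> bool"
  where "short_exact R A f B g C \<longleftrightarrow>
    f \<in> module_hom R A B \<and> g \<in> module_hom R B C \<and>
    inj_on f (carrier A) \<and> f ` carrier A = a_kernel B C g \<and> g ` carrier B = carrier C"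

text \<open>
  The cosets of a submodule of a module on \<open>'m\<close> have type \<open>'m set\<close>, so a quotient of \<open>M\<close> is
  given by a surjective homomorphism from \<open>M\<close>; in particular the class is closed under isomorphism.
\<close>

locale serre_subcategory = cring R for R :: "('a, 'r) ring_scheme" (structure) +
  fixes S :: "('a, 'm) module set"
  assumes is_module: "M \<in> S \<Longrightarrow> module R M"
    and submodule_closed: "\<lbrakk>M \<in> S; submodule N R M\<rbrakk> \<Longrightarrow> M\<lparr>carrier := N\<rparr> \<in> S"
    and quotient_closed:
      "\<lbrakk>M \<in> S; module R Q; h \<in> module_hom R M Q; h ` carrier M = carrier Q\<rbrakk> \<Longrightarrow> Q \<in> S"
    and extension_closed:
      "\<lbrakk>A \<in> S; C \<in> S; module R B; short_exact R A f B g C\<rbrakk> \<Longrightarrow> B \<in> S"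

(* Powers of an ideal are its powers in the monoid of ideals under the ideal product. *)
definition torsion_part ::
    "('a, 'r) ring_scheme \<Rightarrow> 'a set \<Rightarrow> ('a, 'm, 'c) module_scheme \<Rightarrow> 'm set"
  where "torsion_part R I M =
    {x \<in> carrier M. \<exists>k::nat. k \<ge> 1 \<and> (\<forall>r \<in> I [^]\<^bsub>ideals_set R\<^esub> k. r \<odot>\<^bsub>M\<^esub> x = \<zero>\<^bsub>M\<^esub>)}"

definition annihilated_part ::
    "'a set \<Rightarrow> ('a, 'm, 'c) module_scheme \<Rightarrow> 'm set"
  where "annihilated_part I M = {x \<in> carrier M. \<forall>r\<in>I. r \<odot>\<^bsub>M\<^esub> x = \<zero>\<^bsub>M\<^esub>}"

definition C_condition ::
    "('a, 'r) ring_scheme \<Rightarrow> 'a set \<Rightarrow> ('a, 'm) module set \<Rightarrow> bool"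
  where "C_condition R I S \<longleftrightarrow>
    (\<forall>M. module R M \<longrightarrow> torsion_part R I M = carrier M \<longrightarrow>
      M\<lparr>carrier := annihilated_part I M\<rparr> \<in> S \<longrightarrow> M \<in> S)"

end

theory Submission
  imports Defs
begin

text \<open>
  Let \<open>M\<close> be \<open>I\<close>-torsion with \<open>(0 :\<^sub>M I) \<in> S\<close>. Among the ideals \<open>C\<close> with \<open>(0 :\<^sub>M C) \<in> S\<close>, of which \<open>I\<close>
  is one, the descending chain condition provides a minimal one. If it is the zero ideal, then
  \<open>M = (0 :\<^sub>M 0)\<close> lies in \<open>S\<close>. So the point is that a nonzero \<open>C\<close> is never minimal.

  A nonzero ideal \<open>C\<close> of an artinian ring has a subideal \<open>E\<close> such that \<open>C / E\<close> is simple, that is,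
  \<open>C = E + Rv\<close> for some \<open>v \<notin> E\<close> and \<open>P C \<subseteq> E\<close> for some maximal ideal \<open>P\<close>
  (\<open>exists_maximal_proper_subideal\<close>). Multiplication by \<open>v\<close> maps \<open>(0 :\<^sub>M E)\<close> to \<open>(0 :\<^sub>M P)\<close>, and its
  kernel is \<open>(0 :\<^sub>M C)\<close>. Because \<open>M\<close> is \<open>I\<close>-torsion, \<open>(0 :\<^sub>M P) \<subseteq> (0 :\<^sub>M I)\<close> holds for every maximal ideal
  \<open>P\<close> (\<open>annihilated_part_subset_of_torsion\<close>). Hence \<open>(0 :\<^sub>M E)\<close> is an extension of two modules in \<open>S\<close>
  (\<open>restrict_closed_by_scaling\<close>), which contradicts the minimality of \<open>C\<close>.

  The more common argument takes generators \<open>a\<^sub>1, \<dots>, a\<^sub>t\<close> of \<open>I\<close> and embeds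
  \<open>(0 :\<^sub>M I\<^sup>k\<^sup>+\<^sup>1) / (0 :\<^sub>M I)\<close> into \<open>(0 :\<^sub>M I\<^sup>k)\<^sup>t\<close>; it uses that artinian rings are noetherian, and it forms
  direct sums, whose carriers need not fit into the type of \<open>M\<close>. Here every module that occurs is a
  submodule of \<open>M\<close>.
\<close>

section \<open>Ideals of commutative and artinian rings\<close>

lemma (in cring) ideal_annihilator_of_element:
  assumes "x \<in> carrier R"
  shows "ideal {r \<in> carrier R. r \<otimes> x = \<zero>} R"
proof (intro idealI ring_axioms add.subgroupI)
  fix r assume r: "r \<in> {r \<in> carrier R. r \<otimes> x = \<zero>}"
  then show "\<ominus> r \<in> {r \<in> carrier R. r \<otimes> x = \<zero>}"
    using assms by (simp add: l_minus)
next
  fix r s assume "r \<in> {r \<in> carrier R. r \<otimes> x = \<zero>}" "s \<in> carrier R"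
  then show "s \<otimes> r \<in> {r \<in> carrier R. r \<otimes> x = \<zero>}" "r \<otimes> s \<in> {r \<in> carrier R. r \<otimes> x = \<zero>}"
    using assms by (auto simp: m_assoc m_comm[of r s])
next
  have "\<zero> \<in> {r \<in> carrier R. r \<otimes> x = \<zero>}" using assms by simp
  then show "{r \<in> carrier R. r \<otimes> x = \<zero>} \<noteq> {}" by blast
qed (use assms in \<open>auto simp: l_distr\<close>)

text \<open>
  Zorn's lemma, in a form that yields both maximal ideals (\<open>C = R\<close>, \<open>v = 1\<close>) and, when \<open>C / D\<close> is a
  vector space over a residue field, hyperplanes of \<open>C / D\<close>.
\<close>

lemma (in ring) exists_ideal_maximal_avoiding:
  assumes "ideal D R" "D \<subseteq> C" "v \<notin> D"
  obtains E where "ideal E R" "D \<subseteq> E" "E \<subseteq> C" "v \<notin> E"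
    "\<And>J. \<lbrakk>ideal J R; E \<subseteq> J; J \<subseteq> C; v \<notin> J\<rbrakk> \<Longrightarrow> J = E"
proof -
  let ?A = "{E. ideal E R \<and> D \<subseteq> E \<and> E \<subseteq> C \<and> v \<notin> E}"
  have "\<exists>E\<in>?A. \<forall>J\<in>?A. E \<subseteq> J \<longrightarrow> J = E"
  proof (rule subset_Zorn_nonempty)
    show "?A \<noteq> {}" using assms by blast
  next
    fix K assume K: "K \<noteq> {}" "subset.chain ?A K"
    then have "subset.chain {I. ideal I R} K"
      by (auto simp: pred_on.chain_def)
    from chain_Union_is_ideal[OF this] K(1) have "ideal (\<Union>K) R"
      by simp
    moreover have "D \<subseteq> J" "J \<subseteq> C" "v \<notin> J" if "J \<in> K" for J
      using K(2) that by (auto simp: pred_on.chain_def)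
    moreover obtain J where "J \<in> K" using K(1) by blast
    ultimately show "\<Union>K \<in> ?A"
      by (intro CollectI conjI) (simp, meson UnionI subset_iff, meson Sup_least, meson UnionE)
  qed
  then obtain E where "E \<in> ?A" and max: "\<forall>J\<in>?A. E \<subseteq> J \<longrightarrow> J = E" by blast
  then show thesis by (intro that[of E]) auto
qed

lemma (in ring) exists_maximalideal_containing:
  assumes "ideal I R" "\<one> \<notin> I"
  obtains P where "maximalideal P R" "I \<subseteq> P"
proof -
  obtain P where P: "ideal P R" "I \<subseteq> P" "\<one> \<notin> P"
    and max: "\<And>J. \<lbrakk>ideal J R; P \<subseteq> J; J \<subseteq> carrier R; \<one> \<notin> J\<rbrakk> \<Longrightarrow> J = P"
    using exists_ideal_maximal_avoiding[of I "carrier R" \<one>] assms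
      additive_subgroup.a_subset[OF ideal.axioms(1)[OF assms(1)]] by metis
  have "maximalideal P R"
  proof (rule maximalidealI)
    fix J assume "ideal J R" "P \<subseteq> J" "J \<subseteq> carrier R"
    then show "J = P \<or> J = carrier R"
      using max ideal.one_imp_carrier by metis
  qed (use P in auto)
  then show thesis using P that by blast
qed

lemma (in maximalideal) one_not_mem: "\<one> \<notin> I"
  using I_notcarr one_imp_carrier by auto

lemma (in maximalideal) exists_complement_of_one:
  assumes "ideal J R" "\<not> J \<subseteq> I"
  obtains e where "e \<in> J" "\<one> \<ominus> e \<in> I"
proof -
  interpret J: ideal J R by fact
  have ideal: "ideal (I <+>\<^bsub>R\<^esub> J) R" by (rule add_ideals[OF is_ideal assms(1)])
  have I: "I \<subseteq> I <+>\<^bsub>R\<^esub> J"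
    by (force simp: set_add_def' intro: bexI[of _ \<zero>])
  have J: "J \<subseteq> I <+>\<^bsub>R\<^esub> J"
    by (force simp: set_add_def' intro: bexI[of _ \<zero>])
  have "I <+>\<^bsub>R\<^esub> J = carrier R"
    using I_maximal[OF ideal I] additive_subgroup.a_subset[OF ideal.axioms(1)[OF ideal]] J assms(2)
    by blast
  then obtain i e where ie: "i \<in> I" "e \<in> J" "\<one> = i \<oplus> e"
    unfolding set_add_def' by blast
  then have "\<one> \<ominus> e = i"
    using Icarr J.Icarr by (simp add: a_minus_def a_assoc r_neg)
  with ie that show thesis by simp
qed

lemma mem_set_add_cgenideal_iff:
  fixes R (structure)
  shows "w \<in> E <+>\<^bsub>R\<^esub> PIdl v \<longleftrightarrow> (\<exists>e\<in>E. \<exists>r\<in>carrier R. w = e \<oplus> r \<otimes> v)"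
  unfolding set_add_def' cgenideal_def by blast

lemma (in artinian_cring) exists_minimal_ideal:
  assumes "A \<noteq> {}" "\<And>I. I \<in> A \<Longrightarrow> ideal I R"
  obtains I where "I \<in> A" "\<And>J. \<lbrakk>J \<in> A; J \<subseteq> I\<rbrakk> \<Longrightarrow> J = I"
proof -
  have "\<exists>I\<in>A. \<forall>J\<in>A. J \<subseteq> I \<longrightarrow> J = I"
  proof (rule ccontr)
    assume "\<not> ?thesis"
    then have step: "\<forall>I\<in>A. \<exists>J. J \<in> A \<and> J \<subset> I" by blast
    then obtain f where f: "\<And>I. I \<in> A \<Longrightarrow> f I \<in> A \<and> f I \<subset> I" by metis
    obtain I\<^sub>0 where I\<^sub>0: "I\<^sub>0 \<in> A" using assms(1) by blast
    define F where "F n = (f ^^ n) I\<^sub>0" for n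
    have F: "F n \<in> A" for n by (induction n) (auto simp: F_def I\<^sub>0 f)
    have less: "F (Suc n) \<subset> F n" for n using f[OF F[of n]] by (simp add: F_def)
    then have "\<exists>n. \<forall>m\<ge>n. F m = F n"
      using F by (intro descending_chain assms(2)) auto
    then obtain n where "F (Suc n) = F n" by (meson le_SucI order_refl)
    with less[of n] show False by simp
  qed
  then show thesis using that by blast
qed

text \<open>
  This replaces Nakayama's lemma for an ideal that is not known to be finitely generated. Choose \<open>x\<close> with
  \<open>x C \<noteq> 0\<close> and \<open>Rx\<close> minimal, and let \<open>P\<close> be a maximal ideal above the annihilator of \<open>x\<close>. If \<open>p x C \<noteq> 0\<close> for
  some \<open>p \<in> P\<close>, then \<open>Rpx = Rx\<close> by minimality, so \<open>x = r p x\<close>, and \<open>1 - r p\<close> annihilates \<open>x\<close>; then \<open>1 \<in> P\<close>.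
  So \<open>x\<close> annihilates \<open>P C\<close> but not \<open>C\<close>.
\<close>

lemma (in artinian_cring) exists_maximalideal_mult_proper:
  assumes C: "ideal C R" "C \<noteq> {\<zero>}"
  obtains P D where "maximalideal P R" "ideal D R" "D \<subset> C"
    "\<And>p w. \<lbrakk>p \<in> P; w \<in> C\<rbrakk> \<Longrightarrow> p \<otimes> w \<in> D"
proof -
  interpret C: ideal C R by fact
  let ?A = "{PIdl y | y. y \<in> carrier R \<and> (\<exists>w\<in>C. y \<otimes> w \<noteq> \<zero>)}"
  obtain w where "w \<in> C" "w \<noteq> \<zero>" using C(2) C.zero_closed by blast
  then have "PIdl \<one> \<in> ?A" using C.Icarr by (intro CollectI exI[of _ \<one>]) auto
  then obtain B where "B \<in> ?A" and min: "\<And>J. \<lbrakk>J \<in> ?A; J \<subseteq> B\<rbrakk> \<Longrightarrow> J = B"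
    using exists_minimal_ideal[of ?A] cgenideal_ideal by blast
  then obtain x v where x: "x \<in> carrier R" "B = PIdl x" and v: "v \<in> C" "x \<otimes> v \<noteq> \<zero>"
    by blast
  define K where "K = {r \<in> carrier R. r \<otimes> x = \<zero>}"
  have K: "ideal K R" unfolding K_def by (rule ideal_annihilator_of_element[OF x(1)])
  have "x \<noteq> \<zero>" using v C.Icarr by auto
  then have "\<one> \<notin> K" using x(1) by (auto simp: K_def)
  then obtain P where P: "maximalideal P R" "K \<subseteq> P"
    using exists_maximalideal_containing[OF K] by blast
  interpret P: maximalideal P R by (rule P(1))
  have kill: "p \<otimes> w \<in> C \<inter> K" if pw: "p \<in> P" "w \<in> C" for p w
  proof (rule ccontr)
    note carr = P.Icarr[OF pw(1)] C.Icarr[OF pw(2)] x(1)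
    assume "p \<otimes> w \<notin> C \<inter> K"
    then have "(p \<otimes> x) \<otimes> w \<noteq> \<zero>"
      using pw carr C.I_l_closed by (auto simp: K_def m_ac)
    then have "PIdl (p \<otimes> x) \<in> ?A" using carr pw by blast
    moreover have "PIdl (p \<otimes> x) \<subseteq> B"
      unfolding x(2) by (rule cgenideal_minimal[OF cgenideal_ideal[OF x(1)]])
        (use carr in \<open>auto simp: cgenideal_def\<close>)
    ultimately have "PIdl (p \<otimes> x) = PIdl x" unfolding x(2) by (rule min[unfolded x(2)])
    then have "x \<in> PIdl (p \<otimes> x)" using cgenideal_self[OF x(1)] by simp
    then obtain r where r: "r \<in> carrier R" "x = r \<otimes> (p \<otimes> x)"
      by (auto simp: cgenideal_def)
    have "(\<one> \<ominus> r \<otimes> p) \<otimes> x = x \<ominus> r \<otimes> (p \<otimes> x)"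
      using r(1) carr by (simp add: a_minus_def l_distr l_minus m_assoc)
    also have "\<dots> = \<zero>" using r carr by (simp add: a_minus_def r_neg)
    finally have "\<one> \<ominus> r \<otimes> p \<in> K"
      using r(1) carr by (simp add: K_def)
    then have "(\<one> \<ominus> r \<otimes> p) \<oplus> r \<otimes> p \<in> P"
      using P(2) P.I_l_closed[OF pw(1) r(1)] by (intro P.a_closed) auto
    then have "\<one> \<in> P" using r(1) carr by (simp add: a_minus_def a_assoc l_neg)
    then show False using P.one_not_mem by blast
  qed
  have "C \<inter> K \<subset> C" using v x C.Icarr by (auto simp: K_def m_comm)
  then show thesis
    using that[OF P(1) i_intersect[OF C(1) K]] kill by blast
qed

text \<open>
  With \<open>P\<close> and \<open>D\<close> as above, \<open>C / D\<close> is a nonzero vector space over \<open>R / P\<close>. A subspace that is maximal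
  among those avoiding a vector \<open>v \<noteq> 0\<close> is a hyperplane complementary to the line of \<open>v\<close>.
\<close>

lemma (in artinian_cring) exists_maximal_proper_subideal:
  assumes C: "ideal C R" "C \<noteq> {\<zero>}"
  obtains P E v where "maximalideal P R" "ideal E R" "E \<subseteq> C" "v \<in> C" "v \<notin> E"
    "\<And>p w. \<lbrakk>p \<in> P; w \<in> C\<rbrakk> \<Longrightarrow> p \<otimes> w \<in> E" "C \<subseteq> E <+>\<^bsub>R\<^esub> PIdl v"
proof -
  interpret C: ideal C R by fact
  obtain P D where P: "maximalideal P R" and D: "ideal D R" "D \<subset> C"
    and PC: "\<And>p w. \<lbrakk>p \<in> P; w \<in> C\<rbrakk> \<Longrightarrow> p \<otimes> w \<in> D"
    using exists_maximalideal_mult_proper[OF C] by metis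
  interpret P: maximalideal P R by (rule P)
  obtain v where v: "v \<in> C" "v \<notin> D" using D(2) by blast
  obtain E where E: "ideal E R" "D \<subseteq> E" "E \<subseteq> C" "v \<notin> E"
    and max: "\<And>J. \<lbrakk>ideal J R; E \<subseteq> J; J \<subseteq> C; v \<notin> J\<rbrakk> \<Longrightarrow> J = E"
    using exists_ideal_maximal_avoiding[OF D(1) _ v(2), of C] D(2) by blast
  interpret E: ideal E R by (rule E(1))
  have vc: "v \<in> carrier R" using v C.Icarr by blast
  have "w \<in> E <+>\<^bsub>R\<^esub> PIdl v" if w: "w \<in> C" for w
  proof (cases "w \<in> E")
    case True
    then have "w = w \<oplus> \<zero> \<otimes> v" using vc E.Icarr by simp
    then show ?thesis using True
      unfolding mem_set_add_cgenideal_iff by blast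
  next
    case False
    have wc: "w \<in> carrier R" using w C.Icarr by blast
    let ?J = "E <+>\<^bsub>R\<^esub> PIdl w"
    have J: "ideal ?J R" by (rule add_ideals[OF E(1) cgenideal_ideal[OF wc]])
    have "E \<subseteq> ?J"
    proof
      fix e assume e: "e \<in> E"
      then have "e = e \<oplus> \<zero> \<otimes> w" using wc E.Icarr by simp
      then show "e \<in> ?J" using e unfolding mem_set_add_cgenideal_iff by blast
    qed
    moreover have "?J \<subseteq> C"
      using E(3) C.I_l_closed[OF w]
      by (auto simp: mem_set_add_cgenideal_iff intro!: C.a_closed)
    moreover have "w \<in> ?J"
    proof -
      have "w = \<zero> \<oplus> \<one> \<otimes> w" using wc by simp
      then show ?thesis using E.zero_closed unfolding mem_set_add_cgenideal_iff by blast
    qed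
    ultimately have "v \<in> ?J" using max[OF J] False by blast
    then obtain e r where er: "e \<in> E" "r \<in> carrier R" "v = e \<oplus> r \<otimes> w"
      unfolding mem_set_add_cgenideal_iff by blast
    note carr = E.Icarr[OF er(1)] er(2) wc vc
    \<comment> \<open>Modulo \<open>P\<close> the scalar \<open>r\<close> has an inverse \<open>s\<close>, so \<open>v = e + r w\<close> can be solved for \<open>w\<close>.\<close>
    have "r \<notin> P" using PC[of r w] w er E by (metis E.a_closed subsetD)
    then have "\<not> PIdl r \<subseteq> P" using cgenideal_self[OF er(2)] by blast
    then obtain q where q: "q \<in> PIdl r" "\<one> \<ominus> q \<in> P"
      using P.exists_complement_of_one[OF cgenideal_ideal[OF er(2)]] by blast
    then obtain s where s: "s \<in> carrier R" "q = s \<otimes> r"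
      unfolding cgenideal_def by blast
    let ?e = "(\<one> \<ominus> s \<otimes> r) \<otimes> w \<ominus> s \<otimes> e"
    have "(\<one> \<ominus> s \<otimes> r) \<otimes> w \<in> E" using PC[OF _ w] q s E(2) by blast
    moreover have "s \<otimes> e \<in> E" using E.I_l_closed er(1) s(1) by blast
    ultimately have "?e \<in> E" by (simp add: a_minus_def)
    moreover have "w = ?e \<oplus> s \<otimes> v"
      unfolding er(3) using carr(1-3) s(1) by algebra
    ultimately show ?thesis using s(1)
      unfolding mem_set_add_cgenideal_iff by blast
  qed
  then show thesis using that[OF P E(1,3) v(1) E(4)] PC E(2) by blast
qed

section \<open>Submodules annihilated by an ideal\<close>

lemma (in cring) power_mem_ideal_power:
  assumes "ideal I R" "e \<in> I"
  shows "e [^] (k::nat) \<in> I [^]\<^bsub>ideals_set R\<^esub> k"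
proof (induction k)
  case 0
  then show ?case by (simp add: ideals_set_def nat_pow_def)
next
  case (Suc k)
  have "e [^] k \<otimes> e \<in> ideal_prod R (I [^]\<^bsub>ideals_set R\<^esub> k) I"
    by (rule ideal_prod.prod[OF Suc assms(2)])
  then show ?case by (simp add: ideals_set_def nat_pow_def)
qed

lemma (in module) submodule_annihilated_part:
  assumes "I \<subseteq> carrier R"
  shows "submodule (annihilated_part I M) R M"
proof (rule submoduleI)
  fix a x assume ax: "a \<in> carrier R" "x \<in> annihilated_part I M"
  have "r \<odot>\<^bsub>M\<^esub> (a \<odot>\<^bsub>M\<^esub> x) = a \<odot>\<^bsub>M\<^esub> (r \<odot>\<^bsub>M\<^esub> x)" if "r \<in> I" for r
    using ax that assms smult_assoc1[of r a x] smult_assoc1[of a r x] R.m_comm[of r a]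
    by (auto simp: annihilated_part_def)
  then show "a \<odot>\<^bsub>M\<^esub> x \<in> annihilated_part I M"
    using ax by (simp add: annihilated_part_def)
qed (use assms in \<open>auto simp: annihilated_part_def smult_r_minus smult_r_distr subset_iff\<close>)

text \<open>
  If \<open>I\<close> is not contained in \<open>P\<close>, then some \<open>e \<in> I\<close> is congruent to \<open>1\<close> modulo \<open>P\<close> and so fixes every \<open>y\<close>
  that \<open>P\<close> annihilates. Since a power of \<open>I\<close> annihilates \<open>y = e\<^sup>k y\<close>, such a \<open>y\<close> is zero.
\<close>

lemma (in module) annihilated_part_subset_of_torsion:
  assumes I: "ideal I R" and torsion: "torsion_part R I M = carrier M"
    and P: "maximalideal P R"
  shows "annihilated_part P M \<subseteq> annihilated_part I M"
proof (cases "I \<subseteq> P")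
  case True
  then show ?thesis by (auto simp: annihilated_part_def)
next
  case False
  interpret I: ideal I R by fact
  obtain e where e: "e \<in> I" "\<one> \<ominus> e \<in> P"
    using maximalideal.exists_complement_of_one[OF P I False] by blast
  have ec: "e \<in> carrier R" using e I.Icarr by blast
  have "y = \<zero>\<^bsub>M\<^esub>" if y: "y \<in> annihilated_part P M" for y
  proof -
    have yc: "y \<in> carrier M" using y by (simp add: annihilated_part_def)
    have "\<one> = (\<one> \<ominus> e) \<oplus> e" using ec by algebra
    then have "y = ((\<one> \<ominus> e) \<oplus> e) \<odot>\<^bsub>M\<^esub> y" using yc by simp
    also have "\<dots> = (\<one> \<ominus> e) \<odot>\<^bsub>M\<^esub> y \<oplus>\<^bsub>M\<^esub> e \<odot>\<^bsub>M\<^esub> y"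
      using yc ec by (simp add: smult_l_distr)
    also have "\<dots> = e \<odot>\<^bsub>M\<^esub> y"
      using y e yc ec by (simp add: annihilated_part_def)
    finally have ey: "e \<odot>\<^bsub>M\<^esub> y = y" by simp
    have pow: "e [^] k \<odot>\<^bsub>M\<^esub> y = y" for k :: nat
      by (induction k) (use yc ec ey in \<open>simp_all add: smult_assoc1\<close>)
    obtain k :: nat where "\<forall>r \<in> I [^]\<^bsub>ideals_set R\<^esub> k. r \<odot>\<^bsub>M\<^esub> y = \<zero>\<^bsub>M\<^esub>"
      using torsion yc by (auto simp: torsion_part_def)
    then show ?thesis using pow power_mem_ideal_power[OF I e(1), of k] by metis
  qed
  then show ?thesis
    using smult_r_null I.Icarr by (fastforce simp: annihilated_part_def)
qed

section \<open>Serre subcategories\<close>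

lemma (in serre_subcategory) restrict_closed:
  assumes M: "module R M" and L: "M\<lparr>carrier := L\<rparr> \<in> S" and N: "submodule N R M" "N \<subseteq> L"
  shows "M\<lparr>carrier := N\<rparr> \<in> S"
proof -
  have "submodule N R (M\<lparr>carrier := L\<rparr>)"
    by (rule module.module_incl_imp_submodule[OF is_module[OF L]])
      (use N submodule.submodule_is_module[OF N(1) M] in simp_all)
  from submodule_closed[OF L this] show ?thesis by simp
qed

text \<open>Multiplication by \<open>v\<close> exhibits \<open>L\<close> as an extension of the image \<open>v L\<close> by the kernel.\<close>

lemma (in serre_subcategory) restrict_closed_by_scaling:
  assumes M: "module R M" and L: "submodule L R M" and v: "v \<in> carrier R"
    and ker: "M\<lparr>carrier := {x \<in> L. v \<odot>\<^bsub>M\<^esub> x = \<zero>\<^bsub>M\<^esub>}\<rparr> \<in> S"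
    and T: "M\<lparr>carrier := T\<rparr> \<in> S" "(\<lambda>x. v \<odot>\<^bsub>M\<^esub> x) ` L \<subseteq> T"
  shows "M\<lparr>carrier := L\<rparr> \<in> S"
proof -
  interpret M: module R M by fact
  let ?g = "\<lambda>x. v \<odot>\<^bsub>M\<^esub> x"
  note LE = M.submoduleE[OF L]
  have Lc: "x \<in> carrier M" if "x \<in> L" for x using LE(1) that by blast
  have scale: "v \<odot>\<^bsub>M\<^esub> (a \<odot>\<^bsub>M\<^esub> x) = a \<odot>\<^bsub>M\<^esub> (v \<odot>\<^bsub>M\<^esub> x)" if "a \<in> carrier R" "x \<in> L" for a x
    using that v Lc M.smult_assoc1[of v a x] M.smult_assoc1[of a v x] m_comm[of v a] by simp
  have zero: "\<zero>\<^bsub>M\<^esub> \<in> L" using subgroup.one_closed[OF submodule.axioms(1)[OF L]] by simp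
  have "submodule (?g ` L) R M"
  proof (rule M.submoduleI)
    show "\<zero>\<^bsub>M\<^esub> \<in> ?g ` L" using v zero by force
  next
    fix y assume "y \<in> ?g ` L"
    then show "\<ominus>\<^bsub>M\<^esub> y \<in> ?g ` L"
      using v Lc LE(3) by (auto simp: M.smult_r_minus[symmetric])
  next
    fix y z assume "y \<in> ?g ` L" "z \<in> ?g ` L"
    then show "y \<oplus>\<^bsub>M\<^esub> z \<in> ?g ` L"
      using v Lc LE(5) by (auto simp: M.smult_r_distr[symmetric])
  next
    fix a y assume "a \<in> carrier R" "y \<in> ?g ` L"
    then show "a \<odot>\<^bsub>M\<^esub> y \<in> ?g ` L"
      using LE(4) by (auto simp: scale[symmetric])
  qed (use v Lc in auto)
  then have im: "M\<lparr>carrier := ?g ` L\<rparr> \<in> S"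
    using restrict_closed[OF M T(1)] T(2) by blast
  have "short_exact R (M\<lparr>carrier := {x \<in> L. v \<odot>\<^bsub>M\<^esub> x = \<zero>\<^bsub>M\<^esub>}\<rparr>) (\<lambda>x. x) (M\<lparr>carrier := L\<rparr>)
      ?g (M\<lparr>carrier := ?g ` L\<rparr>)"
    using v Lc
    by (auto simp: short_exact_def module_hom_def hom_def a_kernel_def' M.smult_r_distr scale)
  from extension_closed[OF ker im submodule.submodule_is_module[OF L M] this]
  show ?thesis .
qed

theorem corollary2p11:
  fixes R :: "('a, 'r) ring_scheme" and S :: "('a, 'm) module set"
  assumes "artinian_cring R"
    and "serre_subcategory R S"
  shows "\<forall>I. ideal I R \<longrightarrow> C_condition R I S"
  unfolding C_condition_def
proof (intro allI impI)
  fix I and M :: "('a, 'm) module"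
  assume I: "ideal I R" and M: "module R M" and torsion: "torsion_part R I M = carrier M"
    and ann: "M\<lparr>carrier := annihilated_part I M\<rparr> \<in> S"
  interpret artinian_cring R by fact
  interpret S: serre_subcategory R S by fact
  interpret M: module R M by fact
  let ?A = "{C. ideal C R \<and> M\<lparr>carrier := annihilated_part C M\<rparr> \<in> S}"
  obtain C where "C \<in> ?A" and min: "\<And>J. \<lbrakk>J \<in> ?A; J \<subseteq> C\<rbrakk> \<Longrightarrow> J = C"
    using exists_minimal_ideal[of ?A] I ann by blast
  then have C: "ideal C R" "M\<lparr>carrier := annihilated_part C M\<rparr> \<in> S" by auto
  interpret C: ideal C R by (rule C(1))
  have "C = {\<zero>\<^bsub>R\<^esub>}"
  proof (rule ccontr)
    assume "C \<noteq> {\<zero>\<^bsub>R\<^esub>}"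
    then obtain P E v where P: "maximalideal P R" and E: "ideal E R" "E \<subseteq> C"
      and v: "v \<in> C" "v \<notin> E"
      and PC: "\<And>p w. \<lbrakk>p \<in> P; w \<in> C\<rbrakk> \<Longrightarrow> p \<otimes>\<^bsub>R\<^esub> w \<in> E"
      and CE: "C \<subseteq> E <+>\<^bsub>R\<^esub> PIdl\<^bsub>R\<^esub> v"
      using exists_maximal_proper_subideal[OF C(1)] by metis
    interpret P: maximalideal P R by (rule P)
    interpret E: ideal E R by (rule E(1))
    have vc: "v \<in> carrier R" using v C.Icarr by blast
    let ?L = "annihilated_part E M"
    have L: "submodule ?L R M" by (rule M.submodule_annihilated_part[OF E.a_subset])
    \<comment> \<open>Since \<open>C = E + Rv\<close>, the kernel of multiplication by \<open>v\<close> on \<open>(0 :\<^sub>M E)\<close> is \<open>(0 :\<^sub>M C)\<close>.\<close>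
    have "x \<in> annihilated_part C M" if x: "x \<in> ?L" "v \<odot>\<^bsub>M\<^esub> x = \<zero>\<^bsub>M\<^esub>" for x
    proof -
      have xc: "x \<in> carrier M" using x by (simp add: annihilated_part_def)
      have "w \<odot>\<^bsub>M\<^esub> x = \<zero>\<^bsub>M\<^esub>" if w: "w \<in> C" for w
      proof -
        obtain e r where er: "e \<in> E" "r \<in> carrier R" "w = e \<oplus>\<^bsub>R\<^esub> r \<otimes>\<^bsub>R\<^esub> v"
          using subsetD[OF CE w] unfolding mem_set_add_cgenideal_iff by blast
        then show ?thesis
          using x xc vc E.Icarr[OF er(1)] M.smult_r_null[OF er(2)]
          by (simp add: annihilated_part_def M.smult_l_distr M.smult_assoc1)
      qed
      then show ?thesis using xc by (simp add: annihilated_part_def)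
    qed
    then have "{x \<in> ?L. v \<odot>\<^bsub>M\<^esub> x = \<zero>\<^bsub>M\<^esub>} = annihilated_part C M"
      using E(2) v(1) by (auto simp: annihilated_part_def)
    \<comment> \<open>Since \<open>P v \<subseteq> E\<close>, its image is annihilated by \<open>P\<close>.\<close>
    moreover have "(\<lambda>x. v \<odot>\<^bsub>M\<^esub> x) ` ?L \<subseteq> annihilated_part P M"
    proof (rule image_subsetI)
      fix x assume x: "x \<in> ?L"
      have "p \<odot>\<^bsub>M\<^esub> (v \<odot>\<^bsub>M\<^esub> x) = \<zero>\<^bsub>M\<^esub>" if "p \<in> P" for p
        using x PC[OF that v(1)] M.smult_assoc1[of p v x] P.Icarr[OF that] vc
        by (simp add: annihilated_part_def)
      then show "v \<odot>\<^bsub>M\<^esub> x \<in> annihilated_part P M"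
        using x vc by (simp add: annihilated_part_def)
    qed
    then have "(\<lambda>x. v \<odot>\<^bsub>M\<^esub> x) ` ?L \<subseteq> annihilated_part I M"
      using M.annihilated_part_subset_of_torsion[OF I torsion P] by blast
    ultimately have "M\<lparr>carrier := ?L\<rparr> \<in> S"
      using S.restrict_closed_by_scaling[OF M L vc] C(2) ann by simp
    then have "E = C" using min E by blast
    with v show False by blast
  qed
  then have "annihilated_part C M = carrier M" by (auto simp: annihilated_part_def)
  with C(2) show "M \<in> S" by simp
qed

end
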